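(* Let $n\ge2$ and let $K\subset\mathbb{H}^n$ be a convex body of diameter $D$ and circumscribed ball $B$. Then there exists a completion $\widetilde{K}$ of $K$ such that $B$ is also the circumscribed ball of $\widetilde{K}$.
   Context: $\mathbb{H}^n$ is $n$-dimensional hyperbolic space with its geodesic distance. A convex body is a compact (geodesically) convex set with non-empty interior. The circumscribed ball of a compact set is the (unique) closed ball of minimal radius containing it. A set $X\subseteq\mathbb{H}^n$ is complete if $\mathrm{diam}(X\cup\{y\})>\mathrm{diam}(X)$ for each $y\in\mathbb{H}^n\setminus X$. A completion of $K$ is a complete set $\widetilde{K}\supseteq K$ with $\mathrm{diam}\,\widetilde{K}=\mathrm{diam}\,K$. *)

theory Defs
  imports "HOL-Analysis.Analysis"
begin

definition lorentz :: "real \<times> (real ^ 'n) \<Rightarrow> real \<times> (real ^ 'n) \<Rightarrow> real" where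
  "lorentz p q = fst p * fst q - inner (snd p) (snd q)"

text \<open>Hyperboloid model of \<open>n\<close>-dimensional hyperbolic space, where \<open>n = CARD('n)\<close>: the upper
  sheet of \<open>t\<^sup>2 - \<bar>x\<bar>\<^sup>2 = 1\<close>. The geodesic distance \<open>d\<close> is given by \<open>cosh d = lorentz p q\<close>
  (curvature \<open>-1\<close>).\<close>

typedef ('n::finite) hyperbolic =
  "{p :: real \<times> (real ^ 'n). fst p > 0 \<and> lorentz p p = 1}"
  by (rule exI[of _ "(1, 0)"]) (simp add: lorentz_def)

setup_lifting type_definition_hyperbolic

lemma lorentz_commute: "lorentz p q = lorentz q p"
  by (simp add: lorentz_def inner_commute mult.commute)

lemma lorentz_diff_left: "lorentz (p - q) r = lorentz p r - lorentz q r"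
  by (simp add: lorentz_def inner_diff_left algebra_simps)

lemma lorentz_diff_right: "lorentz r (p - q) = lorentz r p - lorentz r q"
  by (simp add: lorentz_def inner_diff_right algebra_simps)

lemma lorentz_scaleR_left: "lorentz (a *\<^sub>R p) r = a * lorentz p r"
  by (simp add: lorentz_def algebra_simps)

lemma lorentz_scaleR_right: "lorentz r (a *\<^sub>R p) = a * lorentz r p"
  by (simp add: lorentz_def algebra_simps)

lemmas lorentz_bilinear = lorentz_diff_left lorentz_diff_right
  lorentz_scaleR_left lorentz_scaleR_right

lemma lorentz_self: "lorentz p p = (fst p)\<^sup>2 - (norm (snd p))\<^sup>2"
  by (simp add: lorentz_def dot_square_norm power2_eq_square)

lemma lorentz_orth:
  fixes q w :: "real \<times> (real ^ 'n)"
  assumes q: "fst q > 0" "lorentz q q = 1" and orth: "lorentz q w = 0"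
  shows "lorentz w w \<le> 0" and "lorentz w w = 0 \<Longrightarrow> w = 0"
proof -
  let ?a = "(norm (snd w))\<^sup>2"
  have nq: "(norm (snd q))\<^sup>2 = (fst q)\<^sup>2 - 1"
    using q(2) by (simp add: lorentz_self)
  have "fst q * fst w = inner (snd q) (snd w)"
    using orth by (simp add: lorentz_def)
  then have "(fst q)\<^sup>2 * (fst w)\<^sup>2 = (inner (snd q) (snd w))\<^sup>2"
    by (metis power_mult_distrib)
  also have "\<dots> \<le> (norm (snd q))\<^sup>2 * ?a"
    by (metis Cauchy_Schwarz_ineq power2_norm_eq_inner)
  finally have le: "(fst q)\<^sup>2 * (fst w)\<^sup>2 \<le> (fst q)\<^sup>2 * ?a - ?a"
    unfolding nq by (simp add: algebra_simps)
  have q2: "(fst q)\<^sup>2 > 0" using q(1) by simp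
  have lw: "lorentz w w = (fst w)\<^sup>2 - ?a"
    by (simp add: lorentz_self)
  have "(fst q)\<^sup>2 * (fst w)\<^sup>2 \<le> (fst q)\<^sup>2 * ?a"
    using le by (smt (verit) zero_le_power2)
  then show "lorentz w w \<le> 0"
    using q2 lw by simp
  show "w = 0" if "lorentz w w = 0"
  proof -
    have e: "(fst w)\<^sup>2 = ?a" using that lw by simp
    with le have "?a \<le> 0" by simp
    then have "snd w = 0" by simp
    moreover from this e have "fst w = 0" by simp
    ultimately show ?thesis by (simp add: prod_eq_iff)
  qed
qed

lemma lorentz_ge_1:
  fixes p q :: "real \<times> (real ^ 'n)"
  assumes p: "fst p > 0" "lorentz p p = 1" and q: "fst q > 0" "lorentz q q = 1"
  shows "lorentz p q \<ge> 1" and "lorentz p q = 1 \<Longrightarrow> p = q"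
proof -
  define w where "w = p - lorentz p q *\<^sub>R q"
  have ow: "lorentz q w = 0"
    using q(2) by (simp add: w_def lorentz_bilinear lorentz_commute)
  have ww: "lorentz w w = 1 - (lorentz p q)\<^sup>2"
    using p(2) q(2) lorentz_commute[of q p]
    by (simp add: w_def lorentz_bilinear power2_eq_square algebra_simps)
  have sq: "(lorentz p q)\<^sup>2 \<ge> 1"
    using lorentz_orth(1)[OF q ow] ww by simp
  have norm_less: "norm (snd x) < fst x" if "fst x > 0" "lorentz x x = 1" for x :: "real \<times> (real ^ 'n)"
  proof (rule power2_less_imp_less)
    show "(norm (snd x))\<^sup>2 < (fst x)\<^sup>2"
      using that(2) by (simp add: lorentz_self)
  qed (use that(1) in simp)
  have "norm (snd p) * norm (snd q) < fst p * fst q"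
    using norm_less[OF p] norm_less[OF q] by (intro mult_strict_mono') simp_all
  moreover have "inner (snd p) (snd q) \<le> norm (snd p) * norm (snd q)"
    by (rule norm_cauchy_schwarz)
  ultimately have "lorentz p q > 0"
    by (simp add: lorentz_def)
  then show "lorentz p q \<ge> 1"
    using sq power2_le_imp_le[of 1 "lorentz p q"] by simp
  show "p = q" if "lorentz p q = 1"
  proof -
    have "lorentz w w = 0" using ww that by simp
    then have "w = 0" by (rule lorentz_orth(2)[OF q ow])
    then show ?thesis using that by (simp add: w_def)
  qed
qed

lemma lorentz_triangle:
  fixes p q r :: "real \<times> (real ^ 'n)"
  assumes p: "fst p > 0" "lorentz p p = 1" and q: "fst q > 0" "lorentz q q = 1"
    and r: "fst r > 0" "lorentz r r = 1"
  shows "arcosh (lorentz p r) \<le> arcosh (lorentz p q) + arcosh (lorentz q r)"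
proof (cases "q = r")
  case True
  then show ?thesis using r by simp
next
  case False
  define A B C where "A = lorentz p q" and "B = lorentz q r" and "C = lorentz p r"
  have A1: "A \<ge> 1" and B1: "B \<ge> 1" and C1: "C \<ge> 1"
    using lorentz_ge_1(1)[OF p q] lorentz_ge_1(1)[OF q r] lorentz_ge_1(1)[OF p r]
    by (simp_all add: A_def B_def C_def)
  have "B \<noteq> 1" using lorentz_ge_1(2)[OF q r] False by (auto simp: B_def)
  with B1 have B2: "B\<^sup>2 > 1" by (simp add: one_less_power)
  define u v where "u = p - A *\<^sub>R q" and "v = r - B *\<^sub>R q"
  note comm = lorentz_commute[of q p] lorentz_commute[of r q] lorentz_commute[of r p]
  have ou: "lorentz q u = 0" and ov: "lorentz q v = 0"
    using q(2) comm by (simp_all add: u_def v_def A_def B_def lorentz_bilinear)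
  have uu: "lorentz u u = 1 - A\<^sup>2" and vv: "lorentz v v = 1 - B\<^sup>2" and uv: "lorentz u v = C - A * B"
    using p(2) q(2) r(2) comm
    by (simp_all add: u_def v_def A_def B_def C_def lorentz_bilinear power2_eq_square algebra_simps)
  define w where "w = (1 - B\<^sup>2) *\<^sub>R u - (C - A * B) *\<^sub>R v"
  have ow: "lorentz q w = 0"
    by (simp add: w_def lorentz_bilinear ou ov)
  have "lorentz w w = (1 - B\<^sup>2) * ((1 - B\<^sup>2) * (1 - A\<^sup>2) - (C - A * B)\<^sup>2)"
    using uu vv uv lorentz_commute[of v u]
    by (simp only: w_def lorentz_bilinear) (simp add: power2_eq_square algebra_simps)
  with lorentz_orth(1)[OF q ow] B2 have "(C - A * B)\<^sup>2 \<le> (1 - B\<^sup>2) * (1 - A\<^sup>2)"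
    by (simp add: mult_le_0_iff)
  also have "\<dots> = (sqrt (A\<^sup>2 - 1) * sqrt (B\<^sup>2 - 1))\<^sup>2"
    using A1 B1 by (simp add: power_mult_distrib algebra_simps)
  finally have "C - A * B \<le> sqrt (A\<^sup>2 - 1) * sqrt (B\<^sup>2 - 1)"
    by (rule power2_le_imp_le) (use A1 B1 in simp)
  also have "\<dots> = sinh (arcosh A) * sinh (arcosh B)"
    using A1 B1 by (simp add: sinh_arcosh_real)
  finally have "C \<le> cosh (arcosh A + arcosh B)"
    using A1 B1 by (simp add: cosh_add)
  then have "cosh (arcosh C) \<le> cosh (arcosh A + arcosh B)"
    using C1 by simp
  then show ?thesis
    using A1 B1 C1 unfolding A_def B_def C_def by (subst (asm) cosh_real_nonneg_le_iff) auto
qed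

instantiation hyperbolic :: (finite) metric_space
begin

lift_definition dist_hyperbolic :: "'a hyperbolic \<Rightarrow> 'a hyperbolic \<Rightarrow> real"
  is "\<lambda>p q. arcosh (lorentz p q)" .

definition uniformity_hyperbolic :: "('a hyperbolic \<times> 'a hyperbolic) filter" where
  "uniformity_hyperbolic = (INF e\<in>{0 <..}. principal {(x, y). dist x y < e})"

definition open_hyperbolic :: "'a hyperbolic set \<Rightarrow> bool" where
  "open_hyperbolic U \<longleftrightarrow> (\<forall>x\<in>U. eventually (\<lambda>(x', y). x' = x \<longrightarrow> y \<in> U) uniformity)"

instance
proof
  fix x y z :: "'a hyperbolic"
  show "dist x y = 0 \<longleftrightarrow> x = y"
  proof (transfer, safe)
    fix a b c d
    assume *: "0 < fst (a, b)" "lorentz (a, b) (a, b) = 1"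
      "0 < fst (c, d)" "lorentz (c, d) (c :: real, d :: real ^ 'a) = 1"
      "arcosh (lorentz (a, b) (c, d)) = 0"
    have "lorentz (a, b) (c, d) \<ge> 1" by (rule lorentz_ge_1(1)[OF *(1-4)])
    then have "lorentz (a, b) (c, d) = 1" using *(5) cosh_arcosh_real by fastforce
    from lorentz_ge_1(2)[OF *(1-4) this] show "a = c" "b = d" by auto
  qed simp
  have "dist x y \<le> dist x z + dist z y"
    by transfer (auto intro!: lorentz_triangle)
  moreover have "dist y z = dist z y"
    by transfer (simp add: lorentz_commute)
  ultimately show "dist x y \<le> dist x z + dist y z" by simp
qed (fact uniformity_hyperbolic_def open_hyperbolic_def)+

end

definition geodesic :: "(real \<Rightarrow> 'a::metric_space) \<Rightarrow> 'a \<Rightarrow> 'a \<Rightarrow> bool" where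
  "geodesic g x y \<longleftrightarrow> g 0 = x \<and> g (dist x y) = y \<and>
     (\<forall>s\<in>{0..dist x y}. \<forall>t\<in>{0..dist x y}. dist (g s) (g t) = \<bar>s - t\<bar>)"

definition geodesically_convex :: "'a::metric_space set \<Rightarrow> bool" where
  "geodesically_convex S \<longleftrightarrow>
     (\<forall>x\<in>S. \<forall>y\<in>S. \<forall>g. geodesic g x y \<longrightarrow> g ` {0..dist x y} \<subseteq> S)"

definition convex_body :: "'a::metric_space set \<Rightarrow> bool" where
  "convex_body K \<longleftrightarrow> compact K \<and> geodesically_convex K \<and> interior K \<noteq> {}"

definition circumscribed_ball :: "'a::metric_space set \<Rightarrow> 'a set \<Rightarrow> bool" where
  "circumscribed_ball K B \<longleftrightarrow>
     (\<exists>c r. r \<ge> 0 \<and> B = cball c r \<and> K \<subseteq> B \<and> (\<forall>c' r'. r' \<ge> 0 \<and> K \<subseteq> cball c' r' \<longrightarrow> r \<le> r'))"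

text \<open>\<^const>\<open>diameter\<close> is real-valued and meaningless on unbounded sets. An unbounded proper subset
  has infinite diameter and hence is never complete, which is what \<^const>\<open>bounded\<close> encodes; it also
  excludes an unbounded whole space, which cannot be a completion of a bounded set.\<close>

definition diam_complete :: "'a::metric_space set \<Rightarrow> bool" where
  "diam_complete X \<longleftrightarrow> bounded X \<and> (\<forall>y. y \<notin> X \<longrightarrow> diameter (X \<union> {y}) > diameter X)"

definition completion_of :: "'a::metric_space set \<Rightarrow> 'a set \<Rightarrow> bool" where
  "completion_of K K' \<longleftrightarrow> diam_complete K' \<and> K \<subseteq> K' \<and> diameter K' = diameter K"

end

theory Submission imports Defs begin

text \<open>
  Let \<open>B\<close> be the closed ball with centre \<open>c\<close> and radius \<open>r\<close>. Since \<open>K\<close> lies in \<open>B\<close> and in the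
  closed ball of radius \<open>D\<close> about each of its points, \<open>r \<le> D \<le> 2 r\<close>. By Zorn's lemma there is a
  set \<open>X\<close> that is maximal among the subsets of \<open>B\<close> that contain \<open>K\<close> and have diameter at most \<open>D\<close>.
  As \<open>K \<subseteq> X \<subseteq> B\<close>, the ball \<open>B\<close> is circumscribed about \<open>X\<close>, and it remains to see that \<open>X\<close> is complete
  in the whole space, not only in \<open>B\<close>.

  Suppose that \<open>y\<close> lies outside \<open>B\<close> and has distance at most \<open>D\<close> from every point of \<open>X\<close>. Extend the
  geodesic from \<open>y\<close> to \<open>c\<close> beyond \<open>c\<close> by the length \<open>D - r\<close>, ending in \<open>w\<close>. Then \<open>w \<in> B\<close> because
  \<open>D - r \<le> r\<close>, and every point of \<open>B\<close> has distance at most \<open>r + (D - r) = D\<close> from \<open>w\<close>. Maximality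
  puts \<open>w\<close> into \<open>X\<close>, yet \<open>dist y w = dist y c + (D - r) > D\<close>, a contradiction.

  The argument works in every metric space in which geodesics can be extended; for hyperbolic
  space this is \<open>hyperbolic_extend_geodesic\<close>.
\<close>

lemma diameter_le_dist:
  fixes S :: "'a::metric_space set"
  assumes "S \<noteq> {}" and "\<And>x y. x \<in> S \<Longrightarrow> y \<in> S \<Longrightarrow> dist x y \<le> d"
  shows "diameter S \<le> d"
  using assms by (auto simp: diameter_def intro!: cSUP_least)

text \<open>The maximal set \<open>X\<close> contains every point of \<open>B\<close> whose distance to all points of \<open>X\<close> is at
  most \<open>D\<close>; points outside \<open>B\<close> are not excluded at this stage.\<close>

lemma exists_maximal_extension_of_bounded_diameter:
  fixes K B :: "'a::metric_space set"
  assumes "D \<ge> 0" and "K \<subseteq> B" and "\<And>x y. x \<in> K \<Longrightarrow> y \<in> K \<Longrightarrow> dist x y \<le> D"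
  obtains X where "K \<subseteq> X" "X \<subseteq> B" "\<And>x y. x \<in> X \<Longrightarrow> y \<in> X \<Longrightarrow> dist x y \<le> D"
    and "\<And>z. z \<in> B \<Longrightarrow> \<forall>x\<in>X. dist z x \<le> D \<Longrightarrow> z \<in> X"
proof -
  define \<A> where "\<A> = {X. K \<subseteq> X \<and> X \<subseteq> B \<and> (\<forall>x\<in>X. \<forall>y\<in>X. dist x y \<le> D)}"
  have "\<exists>M\<in>\<A>. \<forall>X\<in>\<A>. M \<subseteq> X \<longrightarrow> X = M"
  proof (rule subset_Zorn_nonempty)
    show "\<A> \<noteq> {}" using assms by (auto simp: \<A>_def)
  next
    fix \<C> assume "\<C> \<noteq> {}" and chain: "subset.chain \<A> \<C>"
    then have sub: "\<C> \<subseteq> \<A>" by (auto simp: subset.chain_def)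
    have "dist x y \<le> D" if "x \<in> X" "X \<in> \<C>" "y \<in> Y" "Y \<in> \<C>" for x y X Y
    proof -
      have "X \<subseteq> Y \<or> Y \<subseteq> X" using chain that by (auto simp: subset.chain_def)
      then have "\<exists>Z\<in>\<A>. x \<in> Z \<and> y \<in> Z" using that sub by blast
      then show ?thesis by (auto simp: \<A>_def)
    qed
    then show "\<Union>\<C> \<in> \<A>"
      using sub \<open>\<C> \<noteq> {}\<close> by (fastforce simp: \<A>_def)
  qed
  then obtain X where X: "X \<in> \<A>" and max: "\<And>Y. Y \<in> \<A> \<Longrightarrow> X \<subseteq> Y \<Longrightarrow> Y = X"
    by blast
  have absorb: "z \<in> X" if "z \<in> B" "\<forall>x\<in>X. dist z x \<le> D" for z
    using max[of "insert z X"] X that assms(1) by (auto simp: \<A>_def dist_commute)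
  show thesis
  proof (rule that[of X])
    show "K \<subseteq> X" "X \<subseteq> B" using X by (auto simp: \<A>_def)
    show "dist x y \<le> D" if "x \<in> X" "y \<in> X" for x y using X that by (auto simp: \<A>_def)
  qed (use absorb in blast)
qed

text \<open>The hypothesis \<open>extend\<close> says that for \<open>y \<noteq> c\<close> and any length \<open>s\<close> there is a
  point at distance \<open>s\<close> behind \<open>c\<close> as seen from \<open>y\<close>, that is, with equality in the triangle
  inequality.\<close>

lemma completion_in_circumscribed_ball:
  fixes K B :: "'a::metric_space set"
  assumes extend: "\<And>(y::'a) c s. y \<noteq> c \<Longrightarrow> s \<ge> 0 \<Longrightarrow> \<exists>w. dist c w = s \<and> dist y w = dist y c + s"
    and K: "bounded K" "K \<noteq> {}" and B: "circumscribed_ball K B"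
  shows "\<exists>K'. completion_of K K' \<and> circumscribed_ball K' B"
proof -
  define D where "D = diameter K"
  obtain c r where r: "r \<ge> 0" and Bcr: "B = cball c r" and KB: "K \<subseteq> B"
    and min: "\<And>c' r'. r' \<ge> 0 \<Longrightarrow> K \<subseteq> cball c' r' \<Longrightarrow> r \<le> r'"
    using B by (auto simp: circumscribed_ball_def)
  have KD: "dist x y \<le> D" if "x \<in> K" "y \<in> K" for x y
    unfolding D_def using diameter_bounded_bound[OF K(1) that] .
  have D0: "D \<ge> 0"
    unfolding D_def by (rule diameter_ge_0[OF K(1)])
  have rD: "r \<le> D"
  proof -
    obtain x where "x \<in> K" using K(2) by blast
    then have "K \<subseteq> cball x D" using KD by auto
    then show ?thesis by (rule min[OF D0])
  qed
  have "dist x y \<le> 2 * r" if "x \<in> K" "y \<in> K" for x y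
  proof -
    have "dist c x \<le> r" "dist c y \<le> r" using that KB by (auto simp: Bcr)
    then show ?thesis using dist_triangle3[of x y c] by simp
  qed
  then have Dr: "D \<le> 2 * r"
    unfolding D_def by (rule diameter_le_dist[OF K(2)])
  obtain X where KX: "K \<subseteq> X" and XB: "X \<subseteq> B"
    and XD: "\<And>x y. x \<in> X \<Longrightarrow> y \<in> X \<Longrightarrow> dist x y \<le> D"
    and max: "\<And>z. z \<in> B \<Longrightarrow> \<forall>x\<in>X. dist z x \<le> D \<Longrightarrow> z \<in> X"
    using exists_maximal_extension_of_bounded_diameter[OF D0 KB KD] by metis
  have bX: "bounded X"
    using XB by (auto simp: Bcr intro: bounded_subset)
  have "diameter X = D"
  proof (rule antisym)
    show "diameter X \<le> D" using KX K(2) XD by (intro diameter_le_dist) auto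
    show "D \<le> diameter X" unfolding D_def by (rule diameter_subset[OF KX bX])
  qed
  have absorb: "y \<in> X" if y: "\<forall>x\<in>X. dist y x \<le> D" for y
  proof (cases "y \<in> B")
    case True
    then show ?thesis using max y by simp
  next
    case False
    then have far: "dist y c > r" by (simp add: Bcr dist_commute)
    then have "y \<noteq> c" using r by auto
    then obtain w where cw: "dist c w = D - r" and yw: "dist y w = dist y c + (D - r)"
      using extend[of y c "D - r"] rD by auto
    have "dist w x \<le> D" if "x \<in> X" for x
    proof -
      have "dist c x \<le> r" using that XB by (auto simp: Bcr)
      then show ?thesis using dist_triangle3[of w x c] cw by simp
    qed
    moreover have "w \<in> B" using cw Dr by (simp add: Bcr)
    ultimately have "w \<in> X" using max by simp
    then have "dist y w \<le> D" using y by simp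
    with yw far show ?thesis by simp
  qed
  have "diameter (X \<union> {y}) > D" if "y \<notin> X" for y
  proof -
    have "\<not> (\<forall>x\<in>X. dist y x \<le> D)" using absorb that by blast
    then obtain x where x: "x \<in> X" "dist y x > D" by force
    have "dist y x \<le> diameter (X \<union> {y})"
      by (rule diameter_bounded_bound) (use x bX in auto)
    with x show ?thesis by simp
  qed
  then have "completion_of K X"
    using bX KX \<open>diameter X = D\<close> by (simp add: completion_of_def diam_complete_def D_def)
  moreover have "circumscribed_ball X B"
    unfolding circumscribed_ball_def
  proof (intro exI conjI allI impI)
    show "r \<ge> 0" "B = cball c r" "X \<subseteq> B" by fact+
    show "r \<le> r'" if "r' \<ge> 0 \<and> X \<subseteq> cball c' r'" for c' r'
      using that KX by (intro min) auto
  qed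
  ultimately show ?thesis by blast
qed

lemma hyperboloid_upper_sheet:
  fixes p w :: "real \<times> (real ^ 'n)"
  assumes p: "fst p > 0" "lorentz p p = 1" and w: "lorentz w w = 1" and "lorentz p w > 0"
  shows "fst w > 0"
proof (rule ccontr)
  assume "\<not> fst w > 0"
  moreover have "fst w \<noteq> 0"
  proof
    assume "fst w = 0"
    then have "(norm (snd w))\<^sup>2 = - 1" using w by (simp add: lorentz_self)
    then show False using zero_le_power2[of "norm (snd w)"] by linarith
  qed
  ultimately have "fst (- w) > 0" by simp
  moreover have "lorentz (- w) (- w) = 1" using w by (simp add: lorentz_def)
  ultimately have "lorentz p (- w) \<ge> 1" by (rule lorentz_ge_1(1)[OF p])
  moreover have "lorentz p (- w) = - lorentz p w" by (simp add: lorentz_def)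
  ultimately show False using \<open>lorentz p w > 0\<close> by simp
qed

lemma hyperbolic_extend_geodesic:
  fixes y c :: "'n::finite hyperbolic"
  assumes "y \<noteq> c" and "s \<ge> 0"
  shows "\<exists>w. dist c w = s \<and> dist y w = dist y c + s"
proof -
  define R where "R = dist y c"
  define p q where "p = Rep_hyperbolic c" and "q = Rep_hyperbolic y"
  have p: "fst p > 0" "lorentz p p = 1" and q: "fst q > 0" "lorentz q q = 1"
    using Rep_hyperbolic[of c] Rep_hyperbolic[of y] by (auto simp: p_def q_def)
  have "R > 0" using assms(1) by (simp add: R_def)
  then have sR: "sinh R > 0" by simp
  have qp: "lorentz q p = cosh R"
    using lorentz_ge_1(1)[OF q p] by (simp add: R_def dist_hyperbolic.rep_eq p_def q_def)
  then have pq: "lorentz p q = cosh R" by (simp add: lorentz_commute)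
  \<comment> \<open>\<open>v\<close> is the unit tangent vector at \<open>p\<close> that points away from \<open>q\<close>.\<close>
  define v where "v = (1 / sinh R) *\<^sub>R (cosh R *\<^sub>R p - q)"
  have pv: "lorentz p v = 0"
    by (simp add: v_def lorentz_bilinear p pq)
  have qv: "lorentz q v = sinh R"
    using sR sinh_square_eq[of R]
    by (simp add: v_def lorentz_bilinear q qp field_simps power2_eq_square)
  have "lorentz v v = (1 / sinh R) * (cosh R * lorentz p v - lorentz q v)"
    unfolding v_def by (simp only: lorentz_diff_left lorentz_scaleR_left)
  then have vv: "lorentz v v = - 1"
    using sR by (simp add: pv qv)
  define w where "w = cosh s *\<^sub>R p - (- sinh s) *\<^sub>R v"
  have pw: "lorentz p w = cosh s"
    unfolding w_def by (simp only: lorentz_bilinear p pv)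
  have qw: "lorentz q w = cosh (R + s)"
    unfolding w_def by (simp only: lorentz_bilinear qp qv) (simp add: cosh_add algebra_simps)
  have "lorentz w w = (cosh s)\<^sup>2 - (sinh s)\<^sup>2"
    using pv lorentz_commute[of v p]
    unfolding w_def by (simp only: lorentz_bilinear p vv) (simp add: power2_eq_square)
  then have ww: "lorentz w w = 1"
    by (simp add: hyperbolic_pythagoras)
  have "fst w > 0"
    by (rule hyperboloid_upper_sheet[OF p ww]) (simp add: pw)
  with ww have "Rep_hyperbolic (Abs_hyperbolic w) = w"
    by (intro Abs_hyperbolic_inverse) simp
  then have "dist c (Abs_hyperbolic w) = s" "dist y (Abs_hyperbolic w) = R + s"
    using pw qw assms(2) \<open>R > 0\<close> by (simp_all add: dist_hyperbolic.rep_eq p_def q_def arcosh_cosh_real)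
  then show ?thesis by (auto simp: R_def)
qed

theorem theorem1p3:
  fixes K B :: "'n::finite hyperbolic set" and D :: real
  assumes "CARD('n) \<ge> 2"
    and "convex_body K"
    and "diameter K = D"
    and "circumscribed_ball K B"
  shows "\<exists>K'. completion_of K K' \<and> circumscribed_ball K' B"
proof (rule completion_in_circumscribed_ball)
  show "bounded K" "K \<noteq> {}"
    using assms(2) interior_subset[of K] by (auto simp: convex_body_def compact_imp_bounded)
qed (use hyperbolic_extend_geodesic assms(4) in auto)

end
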